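(* If a path $P_n$ on $n\ge 2$ vertices has odd order $n$, then it is $2$-metric antidimensional.
   Context: Graphs are finite and simple; $d_G(u,v)$ is the length of a shortest path between $u$ and $v$. For an ordered set $S=\{u_1,\dots,u_t\}\subseteq V(G)$ ($t\ge1$) and $v\in V(G)$, let $r(v|S)=(d_G(v,u_1),\dots,d_G(v,u_t))$. A nonempty proper subset $S\subset V(G)$ is a $k$-antiresolving set if $k$ is the greatest positive integer such that for every $v\in V(G)-S$ there exist at least $k-1$ different vertices $v_1,\dots,v_{k-1}\in V(G)-S$, all different from $v$, with $r(v|S)=r(v_1|S)=\cdots=r(v_{k-1}|S)$. A connected graph $G$ is $k$-metric antidimensional if $k$ is the largest integer such that $G$ contains a $k$-antiresolving set. *)

theory Defs
  imports "Graph_Theory.Graph_Theory"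
begin

text \<open>
  Finite simple graphs are the symmetric digraphs of the locale \<^locale>\<open>graph\<close>: every edge
  is a pair of opposite arcs, without loops or parallel arcs.
\<close>

definition gdist :: "('a, 'b) pre_digraph \<Rightarrow> 'a \<Rightarrow> 'a \<Rightarrow> ereal" where
  "gdist G u v = wf_digraph.\<mu> G (\<lambda>_. 1) u v"

text \<open>
  The library's distance is an infimum over walks. With unit weights it is the length of a
  shortest path, and it is infinite if there is no path.
\<close>

lemma gdist_shortest_path:
  assumes "graph G" and "pre_digraph.apath G u p v"
    and "\<And>q. pre_digraph.apath G u q v \<Longrightarrow> length p \<le> length q"
  shows "gdist G u v = ereal (real (length p))"
proof -
  interpret graph G by fact
  have cost: "awalk_cost (\<lambda>_. 1) q = real (length q)" for q
    by (induction q) auto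
  have "reachable G u v"
    using assms(2) by (auto simp: reachable_apath)
  then obtain q where q: "apath u q v" "\<mu> (\<lambda>_. 1) u v = ereal (awalk_cost (\<lambda>_. 1) q)"
    using min_cost_awalk[of u v "\<lambda>_. 1"] by auto
  have "\<mu> (\<lambda>_. 1) u v \<le> ereal (awalk_cost (\<lambda>_. 1) p)"
    using assms(2) by (intro min_cost_le_walk_cost) (simp add: apath_def)
  with q assms(3)[OF q(1)] show ?thesis
    by (simp add: gdist_def cost)
qed

text \<open>An ordered set of vertices is a list without repetitions.\<close>

definition metric_rep :: "('a, 'b) pre_digraph \<Rightarrow> 'a \<Rightarrow> 'a list \<Rightarrow> ereal list" where
  "metric_rep G v S = map (gdist G v) S"

definition antiresolving_bound :: "('a, 'b) pre_digraph \<Rightarrow> 'a list \<Rightarrow> nat \<Rightarrow> bool" where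
  "antiresolving_bound G S k \<longleftrightarrow> k \<ge> 1 \<and>
     (\<forall>v \<in> verts G - set S. \<exists>W. W \<subseteq> verts G - set S \<and> v \<notin> W \<and> card W = k - 1 \<and>
        (\<forall>w \<in> W. metric_rep G w S = metric_rep G v S))"

definition antiresolving_set :: "('a, 'b) pre_digraph \<Rightarrow> nat \<Rightarrow> 'a list \<Rightarrow> bool" where
  "antiresolving_set G k S \<longleftrightarrow> distinct S \<and> set S \<noteq> {} \<and> set S \<subset> verts G \<and>
     antiresolving_bound G S k \<and> (\<forall>j. antiresolving_bound G S j \<longrightarrow> j \<le> k)"

definition metric_antidimensional :: "('a, 'b) pre_digraph \<Rightarrow> nat \<Rightarrow> bool" where
  "metric_antidimensional G k \<longleftrightarrow> graph G \<and> Digraph_Component.connected G \<and>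
     (\<exists>S. antiresolving_set G k S) \<and> (\<forall>j S. antiresolving_set G j S \<longrightarrow> j \<le> k)"

definition path_graph :: "('a, 'b) pre_digraph \<Rightarrow> nat \<Rightarrow> bool" where
  "path_graph G n \<longleftrightarrow> graph G \<and>
     (\<exists>vs. distinct vs \<and> length vs = n \<and> verts G = set vs \<and>
        arcs_ends G = {(vs ! i, vs ! j) | i j. i < n \<and> j < n \<and> (j = Suc i \<or> i = Suc j)})"

lemma path_graph_nat:
  defines "A n \<equiv> {(i, j). i < n \<and> j < n \<and> (j = Suc i \<or> i = Suc j)}"
  shows "path_graph \<lparr>verts = {..<n}, arcs = A n, tail = fst, head = snd\<rparr> n"
    (is "path_graph ?G n")
proof -
  have ends: "arcs_ends ?G = A n"
    by (auto simp: arcs_ends_conv)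
  have "A n \<subseteq> {..<n} \<times> {..<n}"
    by (auto simp: A_def)
  then have "finite (A n)"
    by (rule finite_subset) simp
  moreover have "symmetric ?G"
    unfolding symmetric_def ends by (auto simp: A_def sym_def)
  ultimately have "graph ?G"
    by unfold_locales (auto simp: A_def arc_to_ends_def)
  moreover have "A n = {([0..<n] ! i, [0..<n] ! j) | i j. i < n \<and> j < n \<and> (j = Suc i \<or> i = Suc j)}"
  proof (intro set_eqI iffI; clarify)
    fix i j assume "(i, j) \<in> A n"
    then show "\<exists>i' j'. (i, j) = ([0..<n] ! i', [0..<n] ! j') \<and>
        i' < n \<and> j' < n \<and> (j' = Suc i' \<or> i' = Suc j')"
      by (intro exI[of _ i] exI[of _ j]) (auto simp: A_def)
  qed (auto simp: A_def)
  ultimately show ?thesis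
    unfolding path_graph_def ends
    by (intro conjI exI[of _ "[0..<n]"]) (auto simp: atLeast0LessThan)
qed

end

theory Submission
  imports Defs
begin

text \<open>
  In a path, the distance between the vertices at positions \<open>i\<close> and \<open>j\<close> is \<open>\<bar>i - j\<bar>\<close>, so the only vertex
  other than \<open>i\<close> at the same distance from \<open>a\<close> is its mirror image \<open>2 a - i\<close>. Hence every
  antiresolving bound is at most 2. In a path of odd order the middle vertex alone attains it, since
  reflection in the middle maps the path to itself.
\<close>

text \<open>Each arc changes \<open>f\<close> by at most 1, so the triangle inequality along the
  walk gives the bound. With \<open>f\<close> the position on the path, this bounds distances from
  below.\<close>

lemma (in wf_digraph) le_awalk_length_if_dominates_le:
  fixes f :: "'a \<Rightarrow> int"
  assumes "\<And>x y. x \<rightarrow>\<^bsub>G\<^esub> y \<Longrightarrow> \<bar>f x - f y\<bar> \<le> 1" and "awalk u p v"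
  shows "\<bar>f u - f v\<bar> \<le> int (length p)"
  using assms(2)
proof (induction p arbitrary: u)
  case Nil
  then show ?case by (simp add: awalk_Nil_iff)
next
  case (Cons e es)
  then have "e \<in> arcs G" "tail G e = u" "awalk (head G e) es v"
    by (simp_all add: awalk_Cons_iff)
  moreover from this have "\<bar>f u - f (head G e)\<bar> \<le> 1"
    using assms(1) in_arcs_imp_in_arcs_ends by blast
  ultimately show ?case using Cons.IH[of "head G e"] by simp
qed

lemma (in wf_digraph) awalk_of_sequence:
  assumes "x 0 \<in> verts G" and "\<And>k. k < d \<Longrightarrow> x k \<rightarrow>\<^bsub>G\<^esub> x (Suc k)"
  shows "\<exists>p. awalk (x 0) p (x d) \<and> length p = d"
  using assms
proof (induction d)
  case 0
  then show ?case by (intro exI[of _ "[]"]) (simp add: awalk_Nil_iff)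
next
  case (Suc d)
  then obtain p where p: "awalk (x 0) p (x d)" "length p = d" by auto
  from Suc.prems(2)[of d] obtain e where "e \<in> arcs G" "tail G e = x d" "head G e = x (Suc d)"
    by auto
  with p have "awalk (x 0) (p @ [e]) (x (Suc d))"
    by (metis awalk_appendI arc_implies_awalk)
  with p show ?case by (intro exI[of _ "p @ [e]"]) simp
qed

text \<open>Fixes one of the enumerations whose existence \<open>path_graph\<close> asserts, so that
  vertices can be handled through their positions.\<close>

locale path_enumeration = graph G for G :: "('a, 'b) pre_digraph" +
  fixes vs :: "'a list"
  assumes dist: "distinct vs" and verts_eq: "verts G = set vs"
    and ends_eq: "arcs_ends G = {(vs ! i, vs ! j) | i j.
      i < length vs \<and> j < length vs \<and> (j = Suc i \<or> i = Suc j)}"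
begin

lemma awalk_nth:
  assumes "i < length vs" and "j < length vs"
  shows "\<exists>p. awalk (vs ! i) p (vs ! j) \<and> int (length p) = \<bar>int i - int j\<bar>"
proof (cases "i \<le> j")
  case True
  then show ?thesis
    using assms awalk_of_sequence[of "\<lambda>k. vs ! (i + k)" "j - i"]
    by (force simp: verts_eq ends_eq)
next
  case False
  \<comment> \<open>Here the walk descends from \<open>i\<close> to \<open>j\<close>; the bound on
    \<open>k\<close> keeps the natural subtraction from truncating.\<close>
  have "vs ! (i - k) \<rightarrow>\<^bsub>G\<^esub> vs ! (i - Suc k)" if "k < i - j" for k
    unfolding ends_eq using assms that by (simp, intro exI[of _ "i - k"] exI[of _ "i - Suc k"]) auto
  then show ?thesis
    using assms False awalk_of_sequence[of "\<lambda>k. vs ! (i - k)" "i - j"]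
    by (force simp: verts_eq)
qed

lemma awalk_nth_length_ge:
  assumes "i < length vs" and "j < length vs" and "awalk (vs ! i) p (vs ! j)"
  shows "\<bar>int i - int j\<bar> \<le> int (length p)"
proof -
  \<comment> \<open>The position of a vertex in \<open>vs\<close>. Its values off \<open>vs\<close>
    do not matter, since arcs only join entries of \<open>vs\<close>.\<close>
  define f where "f = (\<lambda>x. int (the_inv_into {..<length vs} ((!) vs) x))"
  have inj: "inj_on ((!) vs) {..<length vs}"
    using dist by (auto intro: inj_on_nth)
  have f: "f (vs ! k) = int k" if "k < length vs" for k
    using the_inv_into_f_f[OF inj, of k] that by (simp add: f_def)
  have "\<bar>f x - f y\<bar> \<le> 1" if "x \<rightarrow>\<^bsub>G\<^esub> y" for x y
    using that by (auto simp: ends_eq f)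
  from le_awalk_length_if_dominates_le[of f, OF this assms(3)] show ?thesis
    using assms(1,2) by (simp add: f)
qed

lemma gdist_nth:
  assumes "i < length vs" and "j < length vs"
  shows "gdist G (vs ! i) (vs ! j) = ereal (real_of_int \<bar>int i - int j\<bar>)"
proof -
  have cost: "awalk_cost (\<lambda>_. 1) q = real (length q)" for q
    by (induction q) auto
  obtain p where p: "awalk (vs ! i) p (vs ! j)" "int (length p) = \<bar>int i - int j\<bar>"
    using awalk_nth[OF assms] by blast
  \<comment> \<open>The walk \<open>p\<close> attains the infimum, because its length equals the
    lower bound valid for all walks.\<close>
  have "\<mu> (\<lambda>_. 1) (vs ! i) (vs ! j) = ereal (real (length p))"
    unfolding \<mu>_def
  proof (intro antisym INF_greatest)
    show "(INF q\<in>{q. awalk (vs ! i) q (vs ! j)}. ereal (awalk_cost (\<lambda>_. 1) q)) \<le> ereal (real (length p))"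
      using p(1) by (intro INF_lower2[of p]) (auto simp: cost)
  qed (use awalk_nth_length_ge[OF assms] p(2) in \<open>force simp: cost\<close>)
  then show ?thesis using p(2) by (simp add: gdist_def flip: p(2))
qed

lemma gdist_nth_eq_iff:
  assumes "i < length vs" and "j < length vs" and "a < length vs"
  shows "gdist G (vs ! i) (vs ! a) = gdist G (vs ! j) (vs ! a) \<longleftrightarrow> i = j \<or> i + j = 2 * a"
  using assms by (simp add: gdist_nth del: of_int_abs) linarith

lemma connected_path: "Digraph_Component.connected G" if "vs \<noteq> []"
proof -
  have "x \<rightarrow>\<^sup>*\<^bsub>G\<^esub> y" if "x \<in> verts G" "y \<in> verts G" for x y
    using that awalk_nth by (auto simp: verts_eq in_set_conv_nth reachable_awalk)
  then show ?thesis
    using that by (intro connectedI) (auto simp: verts_eq reachable_mk_symmetric_eq[OF sym_arcs])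
qed

text \<open>A single \<open>v\<close> outside \<open>S\<close> and a single \<open>u\<close> in
  \<open>S\<close> suffice: a vertex other than \<open>v\<close> with the same representation has
  the same distance from \<open>u\<close>, so it can only be the mirror image of \<open>v\<close> in
  \<open>u\<close>.\<close>

lemma antiresolving_bound_le_2:
  assumes "antiresolving_bound G S k" and "set S \<noteq> {}" and "set S \<subset> verts G"
  shows "k \<le> 2"
proof -
  obtain i where i: "i < length vs" "vs ! i \<in> verts G - set S"
    using assms(3) by (metis in_set_conv_nth psubset_imp_ex_mem verts_eq DiffD1)
  obtain a where a: "a < length vs" "vs ! a \<in> set S"
    using assms(2,3) by (metis in_set_conv_nth psubsetD verts_eq ex_in_conv)
  have "\<exists>W\<subseteq>verts G - set S. vs ! i \<notin> W \<and> card W = k - 1 \<and>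
      (\<forall>w\<in>W. metric_rep G w S = metric_rep G (vs ! i) S)"
    using assms(1) i(2) by (simp add: antiresolving_bound_def)
  then obtain W where W: "W \<subseteq> verts G" "vs ! i \<notin> W" "card W = k - 1"
    "\<And>w. w \<in> W \<Longrightarrow> metric_rep G w S = metric_rep G (vs ! i) S"
    by auto
  \<comment> \<open>If the mirror position falls off the path, or the subtraction truncates, the
    inclusion still holds: \<open>W\<close> is then empty.\<close>
  have "W \<subseteq> {vs ! (2 * a - i)}"
  proof
    fix w assume w: "w \<in> W"
    with W(1) obtain j where j: "j < length vs" "w = vs ! j"
      by (metis in_set_conv_nth subsetD verts_eq)
    have "gdist G (vs ! j) (vs ! a) = gdist G (vs ! i) (vs ! a)"
      using W(4)[OF w] a(2) j(2) by (simp add: metric_rep_def)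
    moreover have "j \<noteq> i" using w W(2) j(2) by blast
    ultimately have "j = 2 * a - i"
      using gdist_nth_eq_iff[OF j(1) i(1) a(1)] by auto
    with j show "w \<in> {vs ! (2 * a - i)}" by simp
  qed
  then have "card W \<le> 1"
    using card_mono[of "{vs ! (2 * a - i)}" W] by simp
  with W(3) show ?thesis by simp
qed

lemma antiresolving_bound_middle:
  assumes "length vs = 2 * m + 1"
  shows "antiresolving_bound G [vs ! m] 2"
  unfolding antiresolving_bound_def
proof (intro conjI ballI)
  fix v assume "v \<in> verts G - set [vs ! m]"
  then obtain i where i: "i < length vs" "v = vs ! i" "i \<noteq> m"
    by (auto simp: verts_eq in_set_conv_nth)
  \<comment> \<open>No truncation, as \<open>i\<close> is at most \<open>2 * m\<close>; and
    \<open>i \<noteq> m\<close> makes the mirror image differ from both \<open>v\<close> and the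
    middle.\<close>
  let ?j = "2 * m - i"
  have j: "?j < length vs" "?j \<noteq> i" "?j \<noteq> m" "?j + i = 2 * m" "m < length vs"
    using i assms by auto
  have "gdist G (vs ! ?j) (vs ! m) = gdist G v (vs ! m)"
    using gdist_nth_eq_iff[of ?j i m] i j by simp
  then show "\<exists>W \<subseteq> verts G - set [vs ! m]. v \<notin> W \<and> card W = 2 - 1 \<and>
      (\<forall>w\<in>W. metric_rep G w [vs ! m] = metric_rep G v [vs ! m])"
    using i j dist
    by (intro exI[of _ "{vs ! ?j}"]) (auto simp: metric_rep_def verts_eq nth_eq_iff_index_eq)
qed simp

end

theorem corollary10:
  fixes G :: "('a, 'b) pre_digraph" and n :: nat
  assumes "n \<ge> 2" and "path_graph G n" and "odd n"
  shows "metric_antidimensional G 2"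
proof -
  from assms(2) obtain vs where vs: "length vs = n" "path_enumeration G vs"
    unfolding path_graph_def path_enumeration_def path_enumeration_axioms_def by blast
  then interpret path_enumeration G vs by simp
  from \<open>odd n\<close> obtain m where m: "n = 2 * m + 1" by (rule oddE)
  \<comment> \<open>\<open>n \<ge> 2\<close> excludes the one-vertex path, so the first vertex is
    not the middle one and witnesses that the singleton is a proper subset.\<close>
  have "m < length vs" "0 < length vs" "m \<noteq> 0" using m vs(1) assms(1) by auto
  then have "vs ! 0 \<noteq> vs ! m" "vs ! m \<in> set vs" "vs ! 0 \<in> set vs"
    using dist by (simp_all add: nth_eq_iff_index_eq)
  then have proper: "set [vs ! m] \<subset> verts G"
    by (auto simp: verts_eq)
  have "antiresolving_set G 2 [vs ! m]"
    unfolding antiresolving_set_def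
    using antiresolving_bound_middle[of m] antiresolving_bound_le_2[OF _ _ proper] m vs(1) proper
    by auto
  moreover have "k \<le> 2" if "antiresolving_set G k S" for k S
    using that antiresolving_bound_le_2 by (auto simp: antiresolving_set_def)
  moreover have "vs \<noteq> []" using vs(1) assms(1) by auto
  ultimately show ?thesis
    using connected_path graph_axioms by (auto simp: metric_antidimensional_def)
qed

end
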